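(* Let $\mathsf{Expand}$ be a (possibly randomized) subroutine mapping a pair $(\boldsymbol{X},\mathcal{R})\in[q]^V\times2^V$ to a set $\mathcal{R}''\supseteq\mathcal{R}$, and assume that the chain $\mathcal{M}_{\mathsf{Exp}}$ satisfies the equilibrium condition with respect to the updated graphical model $\mathcal{I}'$. Let $\boldsymbol{X}\sim\mu_{\mathcal{I}}$, and let $(D,\Phi_D)$ be an update, fixed independently of $\boldsymbol{X}$, modifying $\mathcal{I}$ to $\mathcal{I}'$. Then, upon termination, the general dynamic sampling algorithm returns a perfect sample $\boldsymbol{X}'\sim\mu_{\mathcal{I}'}$.
   Context: A graphical model $\mathcal{I}=(V,E,[q],\Phi)$: variables $V$ with domain $[q]$, constraints $E\subseteq 2^V$ with $|e|>1$, distributions $\phi_v$ on $[q]$, functions $\phi_e:[q]^e\to[0,1]$; Gibbs distribution $\mu_{\mathcal{I}}(\sigma)\propto\prod_v\phi_v(\sigma_v)\prod_e\phi_e(\sigma_e)$. For $S\subseteq V$: $E(S)=\{e:e\subseteq S\}$, $\delta(S)=\{e:e\not\subseteq S,e\cap S\neq\emptyset\}$, $E^+(S)=E(S)\cup\delta(S)$; $\mathrm{vbl}(D)$ is the variables in $D$ plus all variables of constraints in $D$. An update $(D,\Phi_D)$ replaces/adds functions for the variables and constraints in $D$ (new constraints $e\subseteq V$, $|e|>1$), giving $\mathcal{I}'$. For $S\subseteq V$ and $\tau\in[q]^{V\setminus S}$ define $w_S^\tau(\sigma)=\prod_{v\in S}\phi_v(\sigma_v)\prod_{e\in E:e\cap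 S\ne\emptyset}\phi_e((\sigma\cup\tau)_e)$ for $\sigma\in[q]^S$, and $\tilde\mu_S^\tau(\sigma)=w_S^\tau(\sigma)/\sum_{\sigma'}w_S^\tau(\sigma')$ if the sum is positive; otherwise $\tilde\mu_S^\tau\equiv0$ (not a well-defined distribution). A random pair $(X,\mathcal{S})\in[q]^V\times2^V$ is conditionally Gibbs w.r.t. $\mathcal{I}$ if for all $S\subseteq V,\tau\in[q]^{V\setminus S}$ with $\Pr[\mathcal{S}=S\wedge X_{V\setminus S}=\tau]>0$, $\tilde\mu_S^\tau$ is a well-defined distribution and $\Pr[X_S=\sigma\mid\mathcal{S}=S\wedge X_{V\setminus S}=\tau]=\tilde\mu_S^\tau(\sigma)$ for all $\sigma\in[q]^S$. A Markov chain on $[q]^V\times2^V$ satisfies the equilibrium condition w.r.t. $\mathcal{I}$ if whenever the current state $(X,\mathcal{S})$ is conditionally Gibbs w.r.t. $\mathcal{I}$, the state after one transition is also conditionally Gibbs w.r.t. $\mathcal{I}$. $\mathcal{M}_{\mathsf{Exp}}$ is the chain on states $(X,\mathcal{S})$ with transition $\mathcal{R}'\gets\mathsf{Expand}(X,V\setminus\mathcal{S})$, $\mathcal{S}'\gets V\setminus\mathcal{R}'$, $X'\gets X$. Local-Resample$(\mathcal{I},\boldsymbol{X},\mathcal{R})$: for each $e\in E^+(\mathcal{R})$ compute $\kappa_e=\frac{1}{\phi_e(X_e)}\min_{x\in[q]^e:x_{e\cap\mathcal{R}}=X_{e\cap\mathcal{R}}}\phi_e(x)$ ($0/0=1$) from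 the current $\boldsymbol{X}$; resample each $X_v$, $v\in\mathcal{R}$, independently from $\phi_v$; for each $e\in E^+(\mathcal{R})$ independently draw $F_e$ with $\Pr[F_e=0]=\kappa_e\phi_e(X_e)$ at the resampled $X$; return $(\boldsymbol{X},\bigcup_{e:F_e=1}e)$. GenResample$(\mathcal{I},\boldsymbol{X},\mathcal{R})$: $\mathcal{R}''\gets\mathsf{Expand}(\boldsymbol{X},\mathcal{R})$, then return Local-Resample$(\mathcal{I},\boldsymbol{X},\mathcal{R}'')$. The general dynamic sampling algorithm: $\mathcal{R}\gets\mathrm{vbl}(D)$; while $\mathcal{R}\neq\emptyset$, $(\boldsymbol{X},\mathcal{R})\gets$ GenResample$(\mathcal{I}',\boldsymbol{X},\mathcal{R})$; return $\boldsymbol{X}$. *)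

theory Defs
  imports "HOL-Probability.Probability"
begin

section \<open>Graphical models\<close>

text \<open>
  The alphabet $[q]$ is \<open>{1..q}\<close>. A configuration in $[q]^S$ is an element of the
  extensional function space \<open>S \<rightarrow>\<^sub>E {1..q}\<close>, and its restriction $\sigma_A$ is
  \<open>restrict \<sigma> A\<close>. The distribution $\phi_v$ is a pmf supported on $[q]$.
\<close>

record 'v gmodel =
  vars :: "'v set"
  constraints :: "'v set set"
  alph :: nat
  vfun :: "'v \<Rightarrow> nat pmf"
  cfun :: "'v set \<Rightarrow> ('v \<Rightarrow> nat) \<Rightarrow> real"

definition configs :: "'v gmodel \<Rightarrow> 'v set \<Rightarrow> ('v \<Rightarrow> nat) set" where
  "configs I S = S \<rightarrow>\<^sub>E {1..alph I}"

definition graphical_model :: "'v gmodel \<Rightarrow> bool" where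
  "graphical_model I \<longleftrightarrow>
     finite (vars I) \<and>
     (\<forall>e\<in>constraints I. e \<subseteq> vars I \<and> card e > 1) \<and>
     (\<forall>v\<in>vars I. set_pmf (vfun I v) \<subseteq> {1..alph I}) \<and>
     (\<forall>e\<in>constraints I. \<forall>x\<in>configs I e. cfun I e x \<in> {0..1})"

definition gibbs_weight :: "'v gmodel \<Rightarrow> ('v \<Rightarrow> nat) \<Rightarrow> real" where
  "gibbs_weight I \<sigma> =
     (\<Prod>v\<in>vars I. pmf (vfun I v) (\<sigma> v)) * (\<Prod>e\<in>constraints I. cfun I e (restrict \<sigma> e))"

text \<open>
  If the partition function vanishes then \<open>gibbs I\<close> is identically \<open>0\<close>, so no
  probability distribution has it as its mass function.
\<close>

definition gibbs :: "'v gmodel \<Rightarrow> ('v \<Rightarrow> nat) \<Rightarrow> real" where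
  "gibbs I \<sigma> =
     (if \<sigma> \<in> configs I (vars I)
      then gibbs_weight I \<sigma> / (\<Sum>\<sigma>'\<in>configs I (vars I). gibbs_weight I \<sigma>')
      else 0)"

definition inner_constraints :: "'v gmodel \<Rightarrow> 'v set \<Rightarrow> 'v set set" where
  "inner_constraints I S = {e \<in> constraints I. e \<subseteq> S}"

definition boundary_constraints :: "'v gmodel \<Rightarrow> 'v set \<Rightarrow> 'v set set" where
  "boundary_constraints I S = {e \<in> constraints I. \<not> e \<subseteq> S \<and> e \<inter> S \<noteq> {}}"

definition incident_constraints :: "'v gmodel \<Rightarrow> 'v set \<Rightarrow> 'v set set" where
  "incident_constraints I S = inner_constraints I S \<union> boundary_constraints I S"

section \<open>Updates\<close>

text \<open>The set $D$ is split into its variables and its constraints.\<close>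

record 'v gupdate =
  upd_vars :: "'v set"
  upd_constraints :: "'v set set"
  upd_vfun :: "'v \<Rightarrow> nat pmf"
  upd_cfun :: "'v set \<Rightarrow> ('v \<Rightarrow> nat) \<Rightarrow> real"

definition valid_update :: "'v gmodel \<Rightarrow> 'v gupdate \<Rightarrow> bool" where
  "valid_update I U \<longleftrightarrow>
     upd_vars U \<subseteq> vars I \<and>
     (\<forall>e\<in>upd_constraints U. e \<subseteq> vars I \<and> card e > 1) \<and>
     (\<forall>v\<in>upd_vars U. set_pmf (upd_vfun U v) \<subseteq> {1..alph I}) \<and>
     (\<forall>e\<in>upd_constraints U. \<forall>x\<in>configs I e. upd_cfun U e x \<in> {0..1})"

definition apply_update :: "'v gmodel \<Rightarrow> 'v gupdate \<Rightarrow> 'v gmodel" where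
  "apply_update I U =
     \<lparr> vars = vars I,
       constraints = constraints I \<union> upd_constraints U,
       alph = alph I,
       vfun = (\<lambda>v. if v \<in> upd_vars U then upd_vfun U v else vfun I v),
       cfun = (\<lambda>e. if e \<in> upd_constraints U then upd_cfun U e else cfun I e) \<rparr>"

definition vbl :: "'v gupdate \<Rightarrow> 'v set" where
  "vbl U = upd_vars U \<union> \<Union> (upd_constraints U)"

section \<open>Conditionally Gibbs pairs and the equilibrium condition\<close>

definition cond_weight ::
  "'v gmodel \<Rightarrow> 'v set \<Rightarrow> ('v \<Rightarrow> nat) \<Rightarrow> ('v \<Rightarrow> nat) \<Rightarrow> real" where
  "cond_weight I S \<tau> \<sigma> =
     (\<Prod>v\<in>S. pmf (vfun I v) (\<sigma> v)) *
     (\<Prod>e\<in>{e \<in> constraints I. e \<inter> S \<noteq> {}}.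
        cfun I e (restrict (merge S (vars I - S) (\<sigma>, \<tau>)) e))"

definition cond_total :: "'v gmodel \<Rightarrow> 'v set \<Rightarrow> ('v \<Rightarrow> nat) \<Rightarrow> real" where
  "cond_total I S \<tau> = (\<Sum>\<sigma>\<in>configs I S. cond_weight I S \<tau> \<sigma>)"

definition cond_dist ::
  "'v gmodel \<Rightarrow> 'v set \<Rightarrow> ('v \<Rightarrow> nat) \<Rightarrow> ('v \<Rightarrow> nat) \<Rightarrow> real" where
  "cond_dist I S \<tau> \<sigma> =
     (if cond_total I S \<tau> > 0 then cond_weight I S \<tau> \<sigma> / cond_total I S \<tau> else 0)"

type_synonym 'v state = "('v \<Rightarrow> nat) \<times> 'v set"

definition states :: "'v gmodel \<Rightarrow> 'v state set" where
  "states I = configs I (vars I) \<times> Pow (vars I)"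

definition conditionally_gibbs :: "'v gmodel \<Rightarrow> 'v state pmf \<Rightarrow> bool" where
  "conditionally_gibbs I P \<longleftrightarrow>
     (\<forall>S \<tau>. S \<subseteq> vars I \<longrightarrow> \<tau> \<in> configs I (vars I - S) \<longrightarrow>
        \<P>(s in measure_pmf P. snd s = S \<and> restrict (fst s) (vars I - S) = \<tau>) > 0 \<longrightarrow>
        cond_total I S \<tau> > 0 \<and>
        (\<forall>\<sigma>\<in>configs I S.
           \<P>(s in measure_pmf P. restrict (fst s) S = \<sigma>
                \<bar> snd s = S \<and> restrict (fst s) (vars I - S) = \<tau>)
           = cond_dist I S \<tau> \<sigma>))"

text \<open>A Markov chain is given by its transition kernel.\<close>

definition equilibrium_condition ::
  "'v gmodel \<Rightarrow> ('v state \<Rightarrow> 'v state pmf) \<Rightarrow> bool" where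
  "equilibrium_condition I K \<longleftrightarrow>
     (\<forall>P. set_pmf P \<subseteq> states I \<longrightarrow> conditionally_gibbs I P \<longrightarrow>
        conditionally_gibbs I (bind_pmf P K))"

section \<open>The dynamic sampling algorithm\<close>

type_synonym 'v expand = "('v \<Rightarrow> nat) \<Rightarrow> 'v set \<Rightarrow> 'v set pmf"

definition expand_subroutine :: "'v gmodel \<Rightarrow> 'v expand \<Rightarrow> bool" where
  "expand_subroutine I Expand \<longleftrightarrow>
     (\<forall>X\<in>configs I (vars I). \<forall>R\<in>Pow (vars I).
        \<forall>R''\<in>set_pmf (Expand X R). R \<subseteq> R'' \<and> R'' \<subseteq> vars I)"

definition expand_chain :: "'v gmodel \<Rightarrow> 'v expand \<Rightarrow> 'v state \<Rightarrow> 'v state pmf" where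
  "expand_chain I Expand = (\<lambda>(X, S).
     do { R' \<leftarrow> Expand X (vars I - S);
          return_pmf (X, vars I - R') })"

text \<open>
  A zero denominator forces a zero numerator, since the restriction of \<open>X\<close> to \<open>e\<close> takes
  part in the minimum; the first branch is the convention $0/0 = 1$.
\<close>

definition kappa :: "'v gmodel \<Rightarrow> ('v \<Rightarrow> nat) \<Rightarrow> 'v set \<Rightarrow> 'v set \<Rightarrow> real" where
  "kappa I X R e =
     (if cfun I e (restrict X e) = 0 then 1
      else Min (cfun I e ` {x \<in> configs I e. restrict x (e \<inter> R) = restrict X (e \<inter> R)})
           / cfun I e (restrict X e))"

text \<open>In the following, \<open>F e\<close> stands for the event $F_e = 1$.\<close>

definition local_resample ::
  "'v gmodel \<Rightarrow> ('v \<Rightarrow> nat) \<Rightarrow> 'v set \<Rightarrow> 'v state pmf" where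
  "local_resample I X R =
     do { Y \<leftarrow> Pi_pmf R undefined (vfun I);
          let X' = override_on X Y R;
          F \<leftarrow> Pi_pmf (incident_constraints I R) False
                 (\<lambda>e. bernoulli_pmf (1 - kappa I X R e * cfun I e (restrict X' e)));
          return_pmf (X', \<Union> {e \<in> incident_constraints I R. F e}) }"

definition gen_resample ::
  "'v expand \<Rightarrow> 'v gmodel \<Rightarrow> ('v \<Rightarrow> nat) \<Rightarrow> 'v set \<Rightarrow> 'v state pmf" where
  "gen_resample Expand I X R =
     do { R'' \<leftarrow> Expand X R;
          local_resample I X R'' }"

text \<open>
  The while loop is a subprobability distribution on outputs; the missing mass
  (the outcome \<open>None\<close>) is the probability of non-termination.
\<close>

partial_function (spmf) resample_loop ::
  "'v expand \<Rightarrow> 'v gmodel \<Rightarrow> ('v \<Rightarrow> nat) \<Rightarrow> 'v set \<Rightarrow> ('v \<Rightarrow> nat) spmf" where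
  "resample_loop Expand I X R =
     (if R = {} then return_spmf X
      else bind_pmf (gen_resample Expand I X R)
             (\<lambda>s. resample_loop Expand I (fst s) (snd s)))"

definition dynamic_sampling ::
  "'v expand \<Rightarrow> 'v gmodel \<Rightarrow> 'v gupdate \<Rightarrow> ('v \<Rightarrow> nat) \<Rightarrow> ('v \<Rightarrow> nat) spmf" where
  "dynamic_sampling Expand I U X = resample_loop Expand (apply_update I U) X (vbl U)"

end

theory Submission
  imports Defs
begin

text \<open>
  A pair $(X, S)$ is conditionally Gibbs iff its mass function factorises as
  $P(X, S) = c(S, X_{V - S}) \cdot w_S(X)$, where $w_S$ collects the variables in $S$ and the
  constraints meeting $S$. Local resampling preserves this form: with $R = V - S$, each boundary
  constraint satisfies $\phi_e(X_e) \kappa_e = \min \phi_e$, a function of $X_R$ alone, and every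
  constraint meeting the new set $S'$ did not fail, so it contributes $\phi_e(Y_e)$ times a function
  of $X_R$; all other factors depend only on $X_R$ and on $Y$ outside $S'$. Expansion preserves
  the form by the equilibrium condition, and so does conditioning on $S \neq V$, that is, on the loop
  not having stopped. Where it stops, $S = V$ and $P(X, V)$ is proportional to the Gibbs weight.
  Hence the output distribution of every finite unrolling of the loop is proportional to the Gibbs
  weight, and this passes to the limit.
\<close>

section \<open>Factorised form of conditionally Gibbs distributions\<close>

lemma graphical_modelD:
  assumes "graphical_model I"
  shows "finite (vars I)" "finite (constraints I)"
    "\<And>e. e \<in> constraints I \<Longrightarrow> e \<subseteq> vars I"
    "\<And>e. e \<in> constraints I \<Longrightarrow> e \<noteq> {}"
    "\<And>e x. e \<in> constraints I \<Longrightarrow> x \<in> configs I e \<Longrightarrow> 0 \<le> cfun I e x"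
    "\<And>e x. e \<in> constraints I \<Longrightarrow> x \<in> configs I e \<Longrightarrow> cfun I e x \<le> 1"
    "\<And>v. v \<in> vars I \<Longrightarrow> set_pmf (vfun I v) \<subseteq> {1..alph I}"
proof -
  show V: "finite (vars I)" using assms by (simp add: graphical_model_def)
  have "constraints I \<subseteq> Pow (vars I)" using assms by (auto simp: graphical_model_def)
  then show "finite (constraints I)" using V by (meson finite_Pow_iff finite_subset)
qed (use assms in \<open>fastforce simp: graphical_model_def\<close>)+

section \<open>Finiteness, restriction and merging of configurations\<close>

lemma finite_configs: "finite S \<Longrightarrow> finite (configs I S)"
  by (simp add: configs_def finite_PiE)

lemma restrict_configs: "X \<in> configs I S \<Longrightarrow> T \<subseteq> S \<Longrightarrow> restrict X T \<in> configs I T"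
  by (auto simp: configs_def PiE_iff)

lemma merge_configs:
  "\<sigma> \<in> configs I S \<Longrightarrow> \<tau> \<in> configs I T \<Longrightarrow> S \<inter> T = {} \<Longrightarrow> merge S T (\<sigma>, \<tau>) \<in> configs I (S \<union> T)"
  by (simp add: configs_def extensional_funcset_def PiE_cancel_merge merge_def extensional_def Pi_def)

lemma restrict_restrict_subset: "A \<subseteq> B \<Longrightarrow> restrict (restrict f B) A = restrict f A"
  by (simp add: Int_absorb1)

lemma finite_states: "graphical_model I \<Longrightarrow> finite (states I)"
  by (simp add: states_def finite_configs graphical_modelD)

lemma pmf_bind_finite:
  assumes "finite A" "set_pmf P \<subseteq> A"
  shows "pmf (bind_pmf P k) x = (\<Sum>s\<in>A. pmf P s * pmf (k s) x)"
  unfolding pmf_bind by (subst integral_measure_pmf[OF assms(1)]) (use assms(2) in auto)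

lemma cond_prob_pmf:
  "\<P>(x in measure_pmf P. A x \<bar> B x)
     = measure_pmf.prob P {x. A x \<and> B x} / measure_pmf.prob P {x. B x}"
  by (simp add: cond_prob_def)

text \<open>This is \<open>cond_weight\<close> as a function of one full configuration instead of
  two halves, so that the same configuration can be split along different sets
  \<open>S\<close>.\<close>

definition block_weight :: "'v gmodel \<Rightarrow> 'v set \<Rightarrow> ('v \<Rightarrow> nat) \<Rightarrow> real" where
  "block_weight I S X =
     (\<Prod>v\<in>S. pmf (vfun I v) (X v)) *
     (\<Prod>e\<in>{e \<in> constraints I. e \<inter> S \<noteq> {}}. cfun I e (restrict X e))"

lemma block_weight_nonneg:
  assumes "graphical_model I" "X \<in> configs I (vars I)"
  shows "0 \<le> block_weight I S X"
  unfolding block_weight_def using assms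
  by (intro mult_nonneg_nonneg prod_nonneg ballI)
    (auto intro!: graphical_modelD(5) intro: restrict_configs dest: graphical_modelD(3))

lemma block_weight_vars:
  "graphical_model I \<Longrightarrow> block_weight I (vars I) X = gibbs_weight I X"
  unfolding block_weight_def gibbs_weight_def
  by (intro arg_cong2[where f = "(*)"] prod.cong) (auto dest: graphical_modelD(3,4))

lemma cond_weight_eq_block_weight:
  assumes "graphical_model I" "S \<subseteq> vars I"
  shows "cond_weight I S \<tau> \<sigma> = block_weight I S (merge S (vars I - S) (\<sigma>, \<tau>))"
  unfolding block_weight_def cond_weight_def
  by (intro arg_cong2[where f = "(*)"] prod.cong) (auto simp: merge_def)

text \<open>The coefficient \<open>c\<close> absorbs both the event probability and the
  normalisation. As nothing is divided, events of probability zero need no separate clause, and the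
  form survives mixing and conditioning on the set.\<close>

definition gibbs_form :: "'v gmodel \<Rightarrow> 'v state pmf \<Rightarrow> bool" where
  "gibbs_form I P \<longleftrightarrow>
     (\<exists>c. \<forall>S X. S \<subseteq> vars I \<longrightarrow> X \<in> configs I (vars I) \<longrightarrow>
        pmf P (X, S) = c S (restrict X (vars I - S)) * block_weight I S X)"

lemma merge_restrict_configs:
  assumes "X \<in> configs I V" "S \<subseteq> V"
  shows "merge S (V - S) (restrict X S, restrict X (V - S)) = X"
  using assms by (auto simp: merge_def configs_def PiE_def extensional_def fun_eq_iff)

lemma restrict_merge_configs:
  assumes "\<sigma> \<in> configs I S" "\<tau> \<in> configs I (V - S)"
  shows "restrict (merge S (V - S) (\<sigma>, \<tau>)) S = \<sigma>"
    "restrict (merge S (V - S) (\<sigma>, \<tau>)) (V - S) = \<tau>"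
  using assms by (auto simp: merge_def configs_def PiE_def extensional_def fun_eq_iff restrict_def)

lemma merge_configs_vars:
  assumes "\<sigma> \<in> configs I S" "\<tau> \<in> configs I (V - S)" "S \<subseteq> V"
  shows "merge S (V - S) (\<sigma>, \<tau>) \<in> configs I V"
  using merge_configs[OF assms(1,2)] assms(3) by (simp add: Un_absorb1)

text \<open>On the support a configuration is determined by its parts on and off \<open>S\<close>,
  so the event is almost surely the injective image of \<open>T\<close> under merging.
  \<open>T = configs I S\<close> yields the conditioning event, a singleton \<open>T\<close> the
  joint event.\<close>

lemma prob_fixed_outside:
  assumes P: "set_pmf P \<subseteq> states I" and S: "S \<subseteq> vars I" and \<tau>: "\<tau> \<in> configs I (vars I - S)"
    and fin: "finite (vars I)" and T: "T \<subseteq> configs I S"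
  shows "measure_pmf.prob P {s. restrict (fst s) S \<in> T \<and> snd s = S
           \<and> restrict (fst s) (vars I - S) = \<tau>}
     = (\<Sum>\<sigma>\<in>T. pmf P (merge S (vars I - S) (\<sigma>, \<tau>), S))"
proof -
  let ?m = "\<lambda>\<sigma>. (merge S (vars I - S) (\<sigma>, \<tau>), S)"
  have finT: "finite T"
    using finite_subset[OF T finite_configs] fin S finite_subset by blast
  have "measure_pmf.prob P {s. restrict (fst s) S \<in> T \<and> snd s = S
           \<and> restrict (fst s) (vars I - S) = \<tau>} = measure_pmf.prob P (?m ` T)"
  proof (rule measure_pmf.finite_measure_eq_AE)
    show "AE s in measure_pmf P. (s \<in> {s. restrict (fst s) S \<in> T \<and> snd s = S
           \<and> restrict (fst s) (vars I - S) = \<tau>}) = (s \<in> ?m ` T)"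
    proof (rule AE_pmfI)
      fix s assume "s \<in> set_pmf P"
      then have "fst s \<in> configs I (vars I)" using P by (auto simp: states_def)
      note X = merge_restrict_configs[OF this S]
      show "(s \<in> {s. restrict (fst s) S \<in> T \<and> snd s = S
           \<and> restrict (fst s) (vars I - S) = \<tau>}) = (s \<in> ?m ` T)"
      proof
        assume "s \<in> {s. restrict (fst s) S \<in> T \<and> snd s = S
           \<and> restrict (fst s) (vars I - S) = \<tau>}"
        then have "s = ?m (restrict (fst s) S)" "restrict (fst s) S \<in> T"
          using X by (auto simp: prod_eq_iff)
        then show "s \<in> ?m ` T" by blast
      next
        assume "s \<in> ?m ` T"
        then obtain \<sigma> where "\<sigma> \<in> T" "s = ?m \<sigma>" by blast
        then show "s \<in> {s. restrict (fst s) S \<in> T \<and> snd s = S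
           \<and> restrict (fst s) (vars I - S) = \<tau>}"
          using restrict_merge_configs[OF _ \<tau>, of \<sigma>] T by auto
      qed
    qed
  qed simp_all
  also have "\<dots> = (\<Sum>s\<in>?m ` T. pmf P s)"
    by (rule measure_measure_pmf_finite) (use finT in simp)
  also have "\<dots> = (\<Sum>\<sigma>\<in>T. pmf P (?m \<sigma>))"
  proof (rule sum.reindex_cong[where l = ?m])
    show "inj_on ?m T"
      by (rule inj_on_inverseI[where g = "\<lambda>s. restrict (fst s) S"])
        (use restrict_merge_configs(1)[OF _ \<tau>] T in auto)
  qed auto
  finally show ?thesis .
qed

lemma prob_outside:
  assumes P: "set_pmf P \<subseteq> states I" and S: "S \<subseteq> vars I" and \<tau>: "\<tau> \<in> configs I (vars I - S)"
    and fin: "finite (vars I)"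
  shows "measure_pmf.prob P {s. snd s = S \<and> restrict (fst s) (vars I - S) = \<tau>}
     = (\<Sum>\<sigma>\<in>configs I S. pmf P (merge S (vars I - S) (\<sigma>, \<tau>), S))"
  unfolding prob_fixed_outside[OF assms order_refl, symmetric]
proof (rule measure_pmf.finite_measure_eq_AE)
  show "AE s in measure_pmf P.
      (s \<in> {s. snd s = S \<and> restrict (fst s) (vars I - S) = \<tau>})
      = (s \<in> {s. restrict (fst s) S \<in> configs I S \<and> snd s = S
           \<and> restrict (fst s) (vars I - S) = \<tau>})"
    using P S by (intro AE_pmfI) (auto 0 3 simp: states_def intro!: restrict_configs[of _ _ "vars I"])
qed simp_all

lemma prob_inside_outside:
  assumes P: "set_pmf P \<subseteq> states I" and S: "S \<subseteq> vars I" and \<tau>: "\<tau> \<in> configs I (vars I - S)"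
    and fin: "finite (vars I)" and \<sigma>: "\<sigma> \<in> configs I S"
  shows "measure_pmf.prob P {s. restrict (fst s) S = \<sigma> \<and> snd s = S
           \<and> restrict (fst s) (vars I - S) = \<tau>}
     = pmf P (merge S (vars I - S) (\<sigma>, \<tau>), S)"
  using prob_fixed_outside[OF P S \<tau> fin, of "{\<sigma>}"] \<sigma> by simp

text \<open>Multiplying the conditional law by the event probability gives the factorised form.
  Conversely, summing out the inside turns it into \<open>c * cond_total\<close>, and
  \<open>c\<close> cancels in the quotient.\<close>

lemma conditionally_gibbs_iff_gibbs_form:
  assumes I: "graphical_model I" and P: "set_pmf P \<subseteq> states I"
  shows "conditionally_gibbs I P \<longleftrightarrow> gibbs_form I P"
proof
  let ?Pr = "\<lambda>S \<tau>. measure_pmf.prob P {s. snd s = S \<and> restrict (fst s) (vars I - S) = \<tau>}"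
  note fin = graphical_modelD(1)[OF I]
  show "gibbs_form I P" if cg: "conditionally_gibbs I P"
    unfolding gibbs_form_def
  proof (intro exI[of _ "\<lambda>S \<tau>. ?Pr S \<tau> / cond_total I S \<tau>"] allI impI)
    fix S X assume S: "S \<subseteq> vars I" and X: "X \<in> configs I (vars I)"
    let ?\<sigma> = "restrict X S" and ?\<tau> = "restrict X (vars I - S)"
    have \<sigma>: "?\<sigma> \<in> configs I S" and \<tau>: "?\<tau> \<in> configs I (vars I - S)"
      using restrict_configs[OF X] S by auto
    have pX: "measure_pmf.prob P {s. restrict (fst s) S = ?\<sigma> \<and> snd s = S
           \<and> restrict (fst s) (vars I - S) = ?\<tau>} = pmf P (X, S)"
      using prob_inside_outside[OF P S \<tau> fin \<sigma>] by (simp only: merge_restrict_configs[OF X S])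
    have w: "cond_weight I S ?\<tau> ?\<sigma> = block_weight I S X"
      by (simp only: cond_weight_eq_block_weight[OF I S] merge_restrict_configs[OF X S])
    show "pmf P (X, S) = ?Pr S ?\<tau> / cond_total I S ?\<tau> * block_weight I S X"
    proof (cases "?Pr S ?\<tau> > 0")
      case True
      then have "cond_total I S ?\<tau> > 0"
        "pmf P (X, S) / ?Pr S ?\<tau> = cond_dist I S ?\<tau> ?\<sigma>"
        using cg[unfolded conditionally_gibbs_def, rule_format, OF S \<tau>] \<sigma>
        by (auto simp: cond_prob_pmf pX)
      then show ?thesis using True w by (simp add: cond_dist_def field_simps)
    next
      \<comment> \<open>Here \<open>cond_total\<close> may be zero; both sides vanish because
        \<open>(X, S)\<close> lies in a null event.\<close>
      case False
      then have z: "?Pr S ?\<tau> = 0" using measure_nonneg[of "measure_pmf P"] by (smt (verit))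
      have "pmf P (X, S) \<le> ?Pr S ?\<tau>"
        unfolding pX[symmetric] by (intro measure_pmf.finite_measure_mono) auto
      then have "pmf P (X, S) = 0" using z pmf_nonneg[of P "(X, S)"] by linarith
      then show ?thesis using z by simp
    qed
  qed
  show "conditionally_gibbs I P" if gf: "gibbs_form I P"
    unfolding conditionally_gibbs_def
  proof (intro allI impI)
    fix S \<tau> assume S: "S \<subseteq> vars I" and \<tau>: "\<tau> \<in> configs I (vars I - S)"
      and pos: "\<P>(s in measure_pmf P. snd s = S \<and> restrict (fst s) (vars I - S) = \<tau>) > 0"
    from gf obtain c where c: "\<And>S X. S \<subseteq> vars I \<Longrightarrow> X \<in> configs I (vars I) \<Longrightarrow>
        pmf P (X, S) = c S (restrict X (vars I - S)) * block_weight I S X"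
      unfolding gibbs_form_def by blast
    let ?m = "\<lambda>\<sigma>. merge S (vars I - S) (\<sigma>, \<tau>)"
    have m: "?m \<sigma> \<in> configs I (vars I)" if "\<sigma> \<in> configs I S" for \<sigma>
      using merge_configs_vars[OF that \<tau> S] .
    have p: "pmf P (?m \<sigma>, S) = c S \<tau> * cond_weight I S \<tau> \<sigma>" if "\<sigma> \<in> configs I S" for \<sigma>
      using c[OF S m[OF that]] restrict_merge_configs(2)[OF that \<tau>]
      by (simp add: cond_weight_eq_block_weight[OF I S])
    have Pr: "?Pr S \<tau> = c S \<tau> * cond_total I S \<tau>"
      unfolding prob_outside[OF P S \<tau> fin] cond_total_def sum_distrib_left
      by (rule sum.cong) (use p in auto)
    \<comment> \<open>The event has probability \<open>c * cond_total\<close>, which is positive, so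
      neither factor is zero; nonnegativity then makes the total positive.\<close>
    have "cond_total I S \<tau> \<ge> 0"
      unfolding cond_total_def using m
      by (intro sum_nonneg)
        (auto simp: cond_weight_eq_block_weight[OF I S] intro: block_weight_nonneg[OF I])
    then have tot: "cond_total I S \<tau> > 0" and c0: "c S \<tau> \<noteq> 0"
      using pos Pr by (auto simp: less_le)
    moreover have "\<P>(s in measure_pmf P. restrict (fst s) S = \<sigma>
                \<bar> snd s = S \<and> restrict (fst s) (vars I - S) = \<tau>) = cond_dist I S \<tau> \<sigma>"
      if \<sigma>: "\<sigma> \<in> configs I S" for \<sigma>
      unfolding cond_prob_pmf prob_inside_outside[OF P S \<tau> fin \<sigma>] Pr p[OF \<sigma>]
      using tot c0 by (simp add: cond_dist_def)
    ultimately show "cond_total I S \<tau> > 0 \<and> (\<forall>\<sigma>\<in>configs I S.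
       \<P>(s in measure_pmf P. restrict (fst s) S = \<sigma>
                \<bar> snd s = S \<and> restrict (fst s) (vars I - S) = \<tau>) = cond_dist I S \<tau> \<sigma>)"
      by blast
  qed
qed

section \<open>Local resampling\<close>

lemma incident_constraints_eq:
  "graphical_model I \<Longrightarrow> incident_constraints I R = {e \<in> constraints I. e \<inter> R \<noteq> {}}"
  by (auto simp: incident_constraints_def inner_constraints_def boundary_constraints_def
      dest: graphical_modelD(4))

text \<open>The numerator of \<open>kappa\<close>, kept apart because it depends on \<open>X\<close>
  only through its part on \<open>R\<close>, whereas the denominator also sees \<open>X\<close> off
  \<open>R\<close>.\<close>

definition min_cfun :: "'v gmodel \<Rightarrow> 'v set \<Rightarrow> 'v set \<Rightarrow> ('v \<Rightarrow> nat) \<Rightarrow> real" where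
  "min_cfun I e R X =
     Min (cfun I e ` {x \<in> configs I e. restrict x (e \<inter> R) = restrict X (e \<inter> R)})"

lemma min_cfun_cong:
  "restrict X (e \<inter> R) = restrict X' (e \<inter> R) \<Longrightarrow> min_cfun I e R X = min_cfun I e R X'"
  by (simp add: min_cfun_def)

text \<open>The restriction of \<open>X\<close> to \<open>e\<close> itself takes part in the
  minimum, which makes the range nonempty and gives the upper bound.\<close>

lemma min_cfun_bounds:
  assumes I: "graphical_model I" and e: "e \<in> constraints I" and X: "X \<in> configs I (vars I)"
  shows "0 \<le> min_cfun I e R X" "min_cfun I e R X \<le> cfun I e (restrict X e)"
proof -
  let ?A = "{x \<in> configs I e. restrict x (e \<inter> R) = restrict X (e \<inter> R)}"
  have "restrict X e \<in> ?A"
    using restrict_configs[OF X graphical_modelD(3)[OF I e]]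
    by (simp add: restrict_restrict_subset)
  moreover have "finite ?A"
    using finite_configs[OF finite_subset[OF graphical_modelD(3,1)[OF I]], of e] e I by auto
  ultimately show "0 \<le> min_cfun I e R X" "min_cfun I e R X \<le> cfun I e (restrict X e)"
    unfolding min_cfun_def using graphical_modelD(5)[OF I e]
    by (auto intro!: Min.boundedI Min.coboundedI)
qed

lemma kappa_eq:
  "kappa I X R e = (if cfun I e (restrict X e) = 0 then 1
     else min_cfun I e R X / cfun I e (restrict X e))"
  by (simp add: kappa_def min_cfun_def)

text \<open>The convention 0/0 = 1 does no harm: if the denominator is zero, the minimum is squeezed
  to zero as well.\<close>

lemma cfun_mult_kappa:
  assumes "graphical_model I" "e \<in> constraints I" "X \<in> configs I (vars I)"
  shows "cfun I e (restrict X e) * kappa I X R e = min_cfun I e R X"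
  using min_cfun_bounds[OF assms, of R] by (auto simp: kappa_eq)

lemma kappa_bounds:
  assumes "graphical_model I" "e \<in> constraints I" "X \<in> configs I (vars I)"
  shows "0 \<le> kappa I X R e" "kappa I X R e \<le> 1"
  using min_cfun_bounds[OF assms, of R] by (auto simp: kappa_eq divide_le_eq_1)

text \<open>For \<open>e\<close> inside \<open>R\<close>, agreement on \<open>e \<inter> R\<close>
  fixes all of \<open>e\<close>, so the minimum ranges over a single point.\<close>

lemma kappa_inner:
  assumes I: "graphical_model I" and e: "e \<in> constraints I" and X: "X \<in> configs I (vars I)"
    and R: "e \<subseteq> R"
  shows "kappa I X R e = 1"
proof -
  have "{x \<in> configs I e. restrict x (e \<inter> R) = restrict X (e \<inter> R)} = {restrict X e}"
    using restrict_configs[OF X graphical_modelD(3)[OF I e]] R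
    by (auto simp: Int_absorb2 configs_def PiE_restrict)
  then show ?thesis by (simp add: kappa_eq min_cfun_def)
qed

text \<open>The value \<open>False\<close> off the incident constraints matches the default of the
  product distribution and makes this set finite.\<close>

definition failures :: "'v gmodel \<Rightarrow> 'v set \<Rightarrow> 'v set \<Rightarrow> ('v set \<Rightarrow> bool) set" where
  "failures I R R' =
     {F \<in> PiE_dflt (incident_constraints I R) False (\<lambda>_. UNIV).
        \<Union> {e \<in> incident_constraints I R. F e} = R'}"

text \<open>Nothing changes off \<open>R\<close>, and the fresh values on \<open>R\<close> are
  forced to be those of \<open>Y\<close>; what remains random is which failure pattern produced
  \<open>R'\<close>.\<close>

lemma pmf_local_resample:
  assumes I: "graphical_model I" and X: "X \<in> configs I (vars I)" and R: "R \<subseteq> vars I"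
    and Y: "Y \<in> configs I (vars I)"
  shows "pmf (local_resample I X R) (Y, R') =
    (if restrict X (vars I - R) = restrict Y (vars I - R)
     then (\<Prod>v\<in>R. pmf (vfun I v) (Y v)) *
          (\<Sum>F\<in>failures I R R'. \<Prod>e\<in>incident_constraints I R.
             if F e then 1 - kappa I X R e * cfun I e (restrict Y e)
             else kappa I X R e * cfun I e (restrict Y e))
     else 0)"
proof -
  let ?E = "incident_constraints I R"
  let ?U = "\<lambda>F. \<Union> {e \<in> ?E. F e}"
  let ?B = "\<lambda>Z. Pi_pmf ?E False (\<lambda>e. bernoulli_pmf (1 - kappa I X R e * cfun I e (restrict Z e)))"
  have finR: "finite R" using R graphical_modelD(1)[OF I] finite_subset by auto
  have E: "?E \<subseteq> constraints I" by (auto simp: incident_constraints_eq[OF I])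
  then have finE: "finite ?E" using graphical_modelD(2)[OF I] finite_subset by auto
  have "local_resample I X R = bind_pmf (Pi_pmf R undefined (vfun I))
     (\<lambda>y. map_pmf (\<lambda>F. (override_on X y R, ?U F)) (?B (override_on X y R)))"
    by (simp add: local_resample_def Let_def map_pmf_def)
  \<comment> \<open>The failure probabilities depend on the resampled configuration; on the event
    that it equals \<open>Y\<close> they may be written with \<open>Y\<close>, which decouples the
    two draws.\<close>
  then have *: "pmf (local_resample I X R) (Y, R') =
      measure_pmf.expectation (Pi_pmf R undefined (vfun I))
        (\<lambda>y. if override_on X y R = Y then measure_pmf.prob (?B Y) {F. ?U F = R'} else 0)"
    by (auto simp: pmf_bind pmf_map vimage_def intro!: Bochner_Integration.integral_cong)
  show ?thesis
  proof (cases "restrict X (vars I - R) = restrict Y (vars I - R)")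
    case False
    then have "override_on X y R \<noteq> Y" for y
      by (metis Diff_iff override_on_apply_notin restrict_ext)
    then show ?thesis using False by (simp add: *)
  next
    case True
    then have XY: "X v = Y v" if "v \<notin> R" for v
      using that X Y by (cases "v \<in> vars I")
        (auto simp: configs_def PiE_def extensional_def dest: fun_cong[where x = v])
    \<comment> \<open>Off \<open>R\<close> the draw takes the default \<open>undefined\<close>, the
      value that \<open>restrict\<close> also uses, so exactly one draw leads to
      \<open>Y\<close>.\<close>
    have "y = restrict Y R"
      if "y \<in> set_pmf (Pi_pmf R undefined (vfun I))" "override_on X y R = Y" for y
      using that set_Pi_pmf_subset[OF finR]
      by (fastforce simp: override_on_def fun_eq_iff restrict_def)
    moreover have "override_on X (restrict Y R) R = Y"
      using XY by (auto simp: override_on_def fun_eq_iff)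
    ultimately have "pmf (local_resample I X R) (Y, R') =
      pmf (Pi_pmf R undefined (vfun I)) (restrict Y R) * measure_pmf.prob (?B Y) {F. ?U F = R'}"
      unfolding * by (subst integral_measure_pmf[where A = "{restrict Y R}"]) (auto split: if_splits)
    also have "pmf (Pi_pmf R undefined (vfun I)) (restrict Y R) = (\<Prod>v\<in>R. pmf (vfun I v) (Y v))"
      by (subst pmf_Pi'[OF finR]) (auto intro!: prod.cong)
    also have "measure_pmf.prob (?B Y) {F. ?U F = R'} = measure_pmf.prob (?B Y) (failures I R R')"
    proof (rule measure_pmf.finite_measure_eq_AE)
      show "AE F in measure_pmf (?B Y). (F \<in> {F. ?U F = R'}) = (F \<in> failures I R R')"
        by (rule AE_pmfI) (use set_Pi_pmf_subset'[OF finE] in \<open>fastforce simp: failures_def PiE_dflt_def\<close>)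
    qed simp_all
    also have "\<dots> = (\<Sum>F\<in>failures I R R'. pmf (?B Y) F)"
      by (rule measure_measure_pmf_finite)
        (auto simp: failures_def intro: finite_subset[OF _ finite_PiE_dflt[OF finE, of "\<lambda>_. UNIV" False]])
    also have "\<dots> = (\<Sum>F\<in>failures I R R'. \<Prod>e\<in>?E.
             if F e then 1 - kappa I X R e * cfun I e (restrict Y e)
             else kappa I X R e * cfun I e (restrict Y e))"
    proof (rule sum.cong[OF refl])
      fix F assume "F \<in> failures I R R'"
      then have "pmf (?B Y) F =
          (\<Prod>e\<in>?E. pmf (bernoulli_pmf (1 - kappa I X R e * cfun I e (restrict Y e))) (F e))"
        by (intro pmf_Pi'[OF finE]) (auto simp: failures_def PiE_dflt_def)
      also have "\<dots> = (\<Prod>e\<in>?E.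
             if F e then 1 - kappa I X R e * cfun I e (restrict Y e)
             else kappa I X R e * cfun I e (restrict Y e))"
      proof (rule prod.cong[OF refl])
        fix e assume "e \<in> ?E"
        then have e: "e \<in> constraints I" using E by auto
        let ?q = "kappa I X R e * cfun I e (restrict Y e)"
        have Ye: "restrict Y e \<in> configs I e"
          using restrict_configs[OF Y graphical_modelD(3)[OF I e]] .
        \<comment> \<open>The parameter of \<open>bernoulli_pmf\<close> is its mass at
          \<open>True\<close> only when it lies in the unit interval.\<close>
        have "0 \<le> ?q" "?q \<le> 1"
          using kappa_bounds[OF I e X, of R] graphical_modelD(5,6)[OF I e Ye]
          by (auto intro: mult_le_one)
        then show "pmf (bernoulli_pmf (1 - ?q)) (F e) = (if F e then 1 - ?q else ?q)"
          by (cases "F e") auto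
      qed
      finally show "pmf (?B Y) F = \<dots>" .
    qed
    finally show ?thesis using True by simp
  qed
qed

section \<open>Local resampling as a transition kernel on states\<close>

lemma merge_partial_configs:
  assumes "x \<in> configs I (V - S)" "Y \<in> configs I V" "S \<subseteq> V"
  shows "merge (V - S) S (x, Y) \<in> configs I V"
    "restrict (merge (V - S) S (x, Y)) (V - S) = x"
    "restrict (merge (V - S) S (x, Y)) S = restrict Y S"
  using assms by (auto simp: merge_def configs_def PiE_def extensional_def fun_eq_iff
      restrict_def Pi_def)

lemma sum_configs_agree:
  assumes S: "S \<subseteq> V" and Y: "Y \<in> configs I V" and V: "finite V"
  shows "(\<Sum>X\<in>configs I V. if restrict X S = restrict Y S then g X else 0)
    = (\<Sum>x\<in>configs I (V - S). (g (merge (V - S) S (x, Y)) :: real))"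
proof -
  have "(\<Sum>X\<in>configs I V. if restrict X S = restrict Y S then g X else 0)
    = (\<Sum>X\<in>{X \<in> configs I V. restrict X S = restrict Y S}. g X)"
    by (subst sum.inter_filter) (auto simp: finite_configs V)
  also have "\<dots> = (\<Sum>x\<in>configs I (V - S). g (merge (V - S) S (x, Y)))"
  proof (rule sum.reindex_bij_witness[where i = "\<lambda>x. merge (V - S) S (x, Y)"
        and j = "\<lambda>X. restrict X (V - S)"])
    fix X assume "X \<in> {X \<in> configs I V. restrict X S = restrict Y S}"
    then have X: "X \<in> configs I V" "\<And>v. v \<in> S \<Longrightarrow> X v = Y v"
      by (auto simp: fun_eq_iff restrict_def split: if_splits)
    show m: "merge (V - S) S (restrict X (V - S), Y) = X"
      using X S by (auto simp: merge_def configs_def PiE_def extensional_def fun_eq_iff)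
    show "restrict X (V - S) \<in> configs I (V - S)" using X restrict_configs by blast
    show "g (merge (V - S) S (restrict X (V - S), Y)) = g X" by (simp only: m)
  next
    fix x assume x: "x \<in> configs I (V - S)"
    show "restrict (merge (V - S) S (x, Y)) (V - S) = x"
      "merge (V - S) S (x, Y) \<in> {X \<in> configs I V. restrict X S = restrict Y S}"
      using merge_partial_configs[OF x Y S] by auto
  qed
  finally show ?thesis .
qed

text \<open>States record the set that is not to be resampled, as in the equilibrium condition,
  hence the two complements.\<close>

definition local_chain :: "'v gmodel \<Rightarrow> 'v state \<Rightarrow> 'v state pmf" where
  "local_chain I = (\<lambda>(X, S).
     map_pmf (\<lambda>(Y, R). (Y, vars I - R)) (local_resample I X (vars I - S)))"

lemma set_pmf_local_resample:
  assumes I: "graphical_model I" and X: "X \<in> configs I (vars I)" and R: "R \<subseteq> vars I"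
  shows "set_pmf (local_resample I X R) \<subseteq> states I"
proof
  fix s assume "s \<in> set_pmf (local_resample I X R)"
  moreover have "finite R" using R graphical_modelD(1)[OF I] finite_subset by auto
  moreover have U: "\<Union> {e \<in> incident_constraints I R. F e} \<subseteq> vars I" for F
    using graphical_modelD(3)[OF I] by (auto simp: incident_constraints_eq[OF I])
  ultimately obtain y F where "y \<in> PiE_dflt R undefined (set_pmf \<circ> vfun I)"
    "s = (override_on X y R, \<Union> {e \<in> incident_constraints I R. F e})"
    by (auto simp: local_resample_def Let_def set_Pi_pmf)
  moreover have "override_on X y R \<in> configs I (vars I)"
    if "y \<in> PiE_dflt R undefined (set_pmf \<circ> vfun I)" for y
  proof -
    have "y v \<in> {1..alph I}" if "v \<in> R" for v
      using \<open>y \<in> _\<close> that graphical_modelD(7)[OF I subsetD[OF R that]] unfolding PiE_dflt_def by auto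
    then show ?thesis
      using X R unfolding configs_def by (intro PiE_I) (auto simp: override_on_def PiE_iff extensional_def)
  qed
  ultimately show "s \<in> states I"
    using U by (auto simp: states_def)
qed

text \<open>Complementation in \<open>vars I\<close> is injective only on subsets of
  \<open>vars I\<close>, so the support of the resampling step enters.\<close>

lemma pmf_local_chain:
  assumes I: "graphical_model I" and X: "X \<in> configs I (vars I)" and T: "T \<subseteq> vars I"
  shows "pmf (local_chain I (X, S)) (Y, T) = pmf (local_resample I X (vars I - S)) (Y, vars I - T)"
proof -
  have "pmf (local_chain I (X, S)) (Y, T) = measure_pmf.prob (local_resample I X (vars I - S))
      ((\<lambda>(Y, R). (Y, vars I - R)) -` {(Y, T)})"
    by (simp add: local_chain_def pmf_map)
  also have "\<dots> = measure_pmf.prob (local_resample I X (vars I - S)) {(Y, vars I - T)}"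
  proof (rule measure_pmf.finite_measure_eq_AE)
    show "AE s in measure_pmf (local_resample I X (vars I - S)).
       (s \<in> (\<lambda>(Y, R). (Y, vars I - R)) -` {(Y, T)}) = (s \<in> {(Y, vars I - T)})"
      using set_pmf_local_resample[OF I X, of "vars I - S"] T
      by (intro AE_pmfI) (fastforce simp: states_def)
  qed simp_all
  finally show ?thesis by (simp add: measure_pmf_single)
qed

text \<open>
  All factors contributed by \<open>e\<close> to the joint probability of the old state, the resampled
  configuration \<open>Y\<close> and the failure pattern \<open>F\<close>. On a boundary constraint the factor
  $\phi_e(X_e)$ of the conditional Gibbs weight has cancelled the denominator of $\kappa_e$,
  so the old configuration enters only through its part \<open>x\<close> on \<open>R\<close>, except when \<open>e\<close> fails.
\<close>

definition constraint_factor ::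
  "'v gmodel \<Rightarrow> 'v set \<Rightarrow> ('v \<Rightarrow> nat) \<Rightarrow> ('v set \<Rightarrow> bool) \<Rightarrow> 'v set \<Rightarrow> ('v \<Rightarrow> nat) \<Rightarrow> real" where
  "constraint_factor I R x F e Y =
     (if e \<inter> R = {} then cfun I e (restrict Y e)
      else if e \<subseteq> R then (if F e then 1 - cfun I e (restrict Y e) else cfun I e (restrict Y e))
      else if F e
        then cfun I e (restrict (merge R (- R) (x, Y)) e)
             - min_cfun I e R x * cfun I e (restrict Y e)
        else min_cfun I e R x * cfun I e (restrict Y e))"

text \<open>What is left once \<open>block_weight I T Y\<close> is split off, with \<open>R'\<close>
  the complement of \<open>T\<close>. The new configuration enters only through its part
  \<open>\<rho>\<close> on \<open>R'\<close>.\<close>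

definition resample_coeff ::
  "'v gmodel \<Rightarrow> 'v set \<Rightarrow> ('v \<Rightarrow> nat) \<Rightarrow> ('v set \<Rightarrow> bool) \<Rightarrow> 'v set \<Rightarrow> ('v \<Rightarrow> nat) \<Rightarrow> real" where
  "resample_coeff I R x F R' \<rho> =
     (\<Prod>v\<in>R'. pmf (vfun I v) (\<rho> v)) *
     (\<Prod>e\<in>{e \<in> constraints I. \<not> e \<subseteq> R'}.
        if e \<inter> R = {} \<or> e \<subseteq> R then 1 else min_cfun I e R x) *
     (\<Prod>e\<in>{e \<in> constraints I. e \<subseteq> R'}. constraint_factor I R x F e \<rho>)"

text \<open>All factors are grouped by constraint. One inside the new resample set sees only
  \<open>Y\<close> on that set; any other meets \<open>T\<close> and splits off exactly the factor
  it has in \<open>block_weight I T Y\<close>.\<close>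

lemma local_resample_term:
  assumes I: "graphical_model I" and S: "S \<subseteq> vars I" and T: "T \<subseteq> vars I"
    and Y: "Y \<in> configs I (vars I)" and x: "x \<in> configs I (vars I - S)"
    and F: "F \<in> failures I (vars I - S) (vars I - T)"
    and X_def: "X = merge (vars I - S) S (x, Y)" and R_def: "R = vars I - S"
  shows "block_weight I S X * ((\<Prod>v\<in>R. pmf (vfun I v) (Y v)) *
       (\<Prod>e\<in>incident_constraints I R.
             if F e then 1 - kappa I X R e * cfun I e (restrict Y e)
             else kappa I X R e * cfun I e (restrict Y e)))
     = resample_coeff I R x F (vars I - T) (restrict Y (vars I - T)) * block_weight I T Y"
proof -
  note V = graphical_modelD(1)[OF I] and finE = graphical_modelD(2)[OF I]
  let ?E = "constraints I" and ?R' = "vars I - T" and ?\<rho> = "restrict Y (vars I - T)"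
  let ?p = "\<lambda>v. pmf (vfun I v) (Y v)"
  let ?B = "\<lambda>e. if F e then 1 - kappa I X R e * cfun I e (restrict Y e)
             else kappa I X R e * cfun I e (restrict Y e)"
  \<comment> \<open>A constraint contributes to the old block weight if it meets \<open>S\<close>
    and to the failure draw if it meets \<open>R\<close>; boundary constraints do both.\<close>
  let ?f = "\<lambda>e. (if e \<inter> S \<noteq> {} then cfun I e (restrict X e) else 1) * (if e \<inter> R \<noteq> {} then ?B e else 1)"
  let ?b = "\<lambda>e. if e \<inter> R = {} \<or> e \<subseteq> R then 1 else min_cfun I e R x"
  have X: "X \<in> configs I (vars I)"
    unfolding X_def by (rule merge_partial_configs(1)[OF x Y S])
  have XR: "X v = x v" if "v \<in> R" for v using that by (auto simp: X_def R_def merge_def)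
  have XS: "X v = Y v" if "v \<in> S" for v using that by (auto simp: X_def R_def merge_def)
  have split: "e \<inter> S = {} \<longleftrightarrow> e \<subseteq> R" "e \<inter> R = {} \<longleftrightarrow> e \<subseteq> S"
    if "e \<in> ?E" for e using graphical_modelD(3)[OF I that] by (auto simp: R_def)
  have f: "?f e = constraint_factor I R x F e Y" if e: "e \<in> ?E" for e
  proof -
    consider "e \<subseteq> S" "e \<inter> R = {}" | "e \<inter> S = {}" "e \<subseteq> R" "e \<inter> R \<noteq> {}"
      | "e \<inter> S \<noteq> {}" "\<not> e \<subseteq> R" "e \<inter> R \<noteq> {}"
      using split[OF e] graphical_modelD(4)[OF I e] by blast
    then show ?thesis
    proof cases
      case 1
      then have "restrict X e = restrict Y e" using XS by (auto simp: fun_eq_iff restrict_def)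
      then show ?thesis using 1 graphical_modelD(4)[OF I e]
        by (auto simp: constraint_factor_def)
    next
      case 2
      then show ?thesis by (auto simp: constraint_factor_def kappa_inner[OF I e X])
    next
      case 3
      \<comment> \<open>Multiplying \<open>1 - kappa * cfun\<close> by the old value of the
        constraint leaves that value minus the minimum times the new value, so the denominator of
        \<open>kappa\<close> disappears in both outcomes.\<close>
      have "min_cfun I e R X = min_cfun I e R x"
        by (rule min_cfun_cong) (auto simp: fun_eq_iff restrict_def XR)
      then have k: "cfun I e (restrict X e) * kappa I X R e = min_cfun I e R x"
        using cfun_mult_kappa[OF I e X] by simp
      have "restrict (merge R (- R) (x, Y)) e = restrict X e"
        using graphical_modelD(3)[OF I e] by (auto simp: fun_eq_iff restrict_def X_def R_def merge_def)
      then show ?thesis using 3 k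
        by (simp add: constraint_factor_def right_diff_distrib mult.assoc[symmetric])
    qed
  qed
  have "block_weight I S X * ((\<Prod>v\<in>R. ?p v) * (\<Prod>e\<in>incident_constraints I R. ?B e))
     = ((\<Prod>v\<in>S. ?p v) * (\<Prod>v\<in>R. ?p v)) * (\<Prod>e\<in>?E. ?f e)"
    unfolding block_weight_def incident_constraints_eq[OF I] prod.distrib
      prod.inter_filter[OF finE]
    using XS by simp
  \<comment> \<open>Old weights on \<open>S\<close>, where \<open>X\<close> and \<open>Y\<close>
    agree, and fresh draws on \<open>R\<close> give the variable weight of \<open>Y\<close> on all
    of \<open>vars I\<close>, which can be split again along \<open>T\<close>.\<close>
  also have "(\<Prod>v\<in>S. ?p v) * (\<Prod>v\<in>R. ?p v) = (\<Prod>v\<in>vars I. ?p v)"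
    unfolding R_def using prod.subset_diff[OF S V, of ?p] by (simp add: mult.commute)
  also have "\<dots> = (\<Prod>v\<in>?R'. pmf (vfun I v) (?\<rho> v)) * (\<Prod>v\<in>T. ?p v)"
    using prod.subset_diff[OF T V, of ?p] by simp
  also have "(\<Prod>e\<in>?E. ?f e) = (\<Prod>e\<in>?E. constraint_factor I R x F e Y)"
    using f by (intro prod.cong) auto
  also have "\<dots> = (\<Prod>e\<in>{e \<in> ?E. e \<subseteq> ?R'}. constraint_factor I R x F e Y)
      * (\<Prod>e\<in>{e \<in> ?E. \<not> e \<subseteq> ?R'}. constraint_factor I R x F e Y)"
    by (subst prod.union_disjoint[symmetric]) (auto simp: finE intro!: prod.cong)
  also have "(\<Prod>e\<in>{e \<in> ?E. e \<subseteq> ?R'}. constraint_factor I R x F e Y)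
     = (\<Prod>e\<in>{e \<in> ?E. e \<subseteq> ?R'}. constraint_factor I R x F e ?\<rho>)"
  proof (intro prod.cong refl)
    fix e assume "e \<in> {e \<in> ?E. e \<subseteq> ?R'}"
    then have "restrict Y e = restrict ?\<rho> e"
      "restrict (merge R (- R) (x, Y)) e = restrict (merge R (- R) (x, ?\<rho>)) e"
      by (auto simp: fun_eq_iff restrict_def merge_def)
    then show "constraint_factor I R x F e Y = constraint_factor I R x F e ?\<rho>"
      by (simp only: constraint_factor_def)
  qed
  \<comment> \<open>A constraint that reaches outside \<open>R'\<close> did not fail, since \<open>R'\<close> is the union of the failed ones.\<close>
  also have "(\<Prod>e\<in>{e \<in> ?E. \<not> e \<subseteq> ?R'}. constraint_factor I R x F e Y)
     = (\<Prod>e\<in>{e \<in> ?E. \<not> e \<subseteq> ?R'}. ?b e) * (\<Prod>e\<in>{e \<in> ?E. \<not> e \<subseteq> ?R'}. cfun I e (restrict Y e))"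
    unfolding prod.distrib[symmetric]
  proof (intro prod.cong refl)
    fix e assume e: "e \<in> {e \<in> ?E. \<not> e \<subseteq> ?R'}"
    then have "\<not> F e" if "e \<inter> R \<noteq> {}"
      using F that by (auto simp: failures_def incident_constraints_eq[OF I] R_def)
    then show "constraint_factor I R x F e Y = ?b e * cfun I e (restrict Y e)"
      by (auto simp: constraint_factor_def)
  qed
  also have "{e \<in> ?E. \<not> e \<subseteq> ?R'} = {e \<in> ?E. e \<inter> T \<noteq> {}}"
    using graphical_modelD(3)[OF I] by blast
  finally show ?thesis
    unfolding block_weight_def resample_coeff_def
    using \<open>{e \<in> ?E. \<not> e \<subseteq> ?R'} = {e \<in> ?E. e \<inter> T \<noteq> {}}\<close> by (simp only: mult_ac)
qed

lemma local_chain_gibbs_form: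
  assumes I: "graphical_model I" and P: "set_pmf P \<subseteq> states I" and gf: "gibbs_form I P"
  shows "gibbs_form I (bind_pmf P (local_chain I))"
proof -
  note V = graphical_modelD(1)[OF I]
  from gf obtain c where c: "\<And>S X. S \<subseteq> vars I \<Longrightarrow> X \<in> configs I (vars I) \<Longrightarrow>
      pmf P (X, S) = c S (restrict X (vars I - S)) * block_weight I S X"
    unfolding gibbs_form_def by blast
  \<comment> \<open>The sum runs over all histories: the old set \<open>S\<close>, the overwritten
    values \<open>x\<close> and the failure pattern \<open>F\<close>. The factor
    \<open>block_weight I T Y\<close> depends on none of them.\<close>
  define c' where "c' T \<rho> = (\<Sum>S\<in>Pow (vars I). \<Sum>x\<in>configs I (vars I - S).
      \<Sum>F\<in>failures I (vars I - S) (vars I - T).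
        c S x * resample_coeff I (vars I - S) x F (vars I - T) \<rho>)" for T \<rho>
  have "pmf (bind_pmf P (local_chain I)) (Y, T) = c' T (restrict Y (vars I - T)) * block_weight I T Y"
    if T: "T \<subseteq> vars I" and Y: "Y \<in> configs I (vars I)" for T Y
  proof -
    let ?\<rho> = "restrict Y (vars I - T)"
    let ?m = "\<lambda>S x. merge (vars I - S) S (x, Y)"
    let ?q = "\<lambda>S X. (\<Prod>v\<in>vars I - S. pmf (vfun I v) (Y v)) *
          (\<Sum>F\<in>failures I (vars I - S) (vars I - T). \<Prod>e\<in>incident_constraints I (vars I - S).
             if F e then 1 - kappa I X (vars I - S) e * cfun I e (restrict Y e)
             else kappa I X (vars I - S) e * cfun I e (restrict Y e))"
    have "pmf (bind_pmf P (local_chain I)) (Y, T)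
        = (\<Sum>s\<in>states I. pmf P s * pmf (local_chain I s) (Y, T))"
      by (rule pmf_bind_finite[OF finite_states[OF I] P])
    also have "\<dots> = (\<Sum>S\<in>Pow (vars I). \<Sum>X\<in>configs I (vars I).
        pmf P (X, S) * pmf (local_chain I (X, S)) (Y, T))"
      unfolding states_def by (subst sum.swap) (simp add: sum.cartesian_product split_def)
    also have "\<dots> = (\<Sum>S\<in>Pow (vars I). \<Sum>x\<in>configs I (vars I - S).
        \<Sum>F\<in>failures I (vars I - S) (vars I - T).
        c S x * resample_coeff I (vars I - S) x F (vars I - T) ?\<rho> * block_weight I T Y)"
    proof (rule sum.cong[OF refl])
      fix S assume "S \<in> Pow (vars I)"
      then have S: "S \<subseteq> vars I" by simp
      \<comment> \<open>Only configurations agreeing with \<open>Y\<close> on \<open>S\<close> lead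
        to \<open>Y\<close>, so just the overwritten values remain to be summed.\<close>
      have "(\<Sum>X\<in>configs I (vars I). pmf P (X, S) * pmf (local_chain I (X, S)) (Y, T))
        = (\<Sum>X\<in>configs I (vars I). if restrict X S = restrict Y S then pmf P (X, S) * ?q S X else 0)"
        using S by (intro sum.cong refl)
          (simp add: pmf_local_chain[OF I _ T] pmf_local_resample[OF I _ _ Y] double_diff)
      also have "\<dots> = (\<Sum>x\<in>configs I (vars I - S). pmf P (?m S x, S) * ?q S (?m S x))"
        by (rule sum_configs_agree[OF S Y V])
      also have "\<dots> = (\<Sum>x\<in>configs I (vars I - S).
        \<Sum>F\<in>failures I (vars I - S) (vars I - T).
        c S x * resample_coeff I (vars I - S) x F (vars I - T) ?\<rho> * block_weight I T Y)"
      proof (rule sum.cong[OF refl])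
        fix x assume x: "x \<in> configs I (vars I - S)"
        have "?m S x \<in> configs I (vars I)" "restrict (?m S x) (vars I - S) = x"
          by (rule merge_partial_configs[OF x Y S])+
        then have "pmf P (?m S x, S) = c S x * block_weight I S (?m S x)"
          using c[OF S] by simp
        then show "pmf P (?m S x, S) * ?q S (?m S x)
          = (\<Sum>F\<in>failures I (vars I - S) (vars I - T).
          c S x * resample_coeff I (vars I - S) x F (vars I - T) ?\<rho> * block_weight I T Y)"
          by (simp only: local_resample_term[OF I S T Y x _ refl refl, symmetric]
              sum_distrib_left mult.assoc cong: sum.cong)
      qed
      finally show "(\<Sum>X\<in>configs I (vars I). pmf P (X, S) * pmf (local_chain I (X, S)) (Y, T)) = \<dots>" .
    qed
    finally show ?thesis by (simp add: c'_def sum_distrib_right)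
  qed
  then show ?thesis unfolding gibbs_form_def by blast
qed

section \<open>The resampling loop\<close>

text \<open>One iteration of the loop is expansion followed by local resampling as kernels on
  states; the complements cancel because every set involved lies in \<open>vars I\<close>.\<close>

lemma bind_gen_resample:
  assumes I: "graphical_model I" and Ex: "expand_subroutine I Expand" and s: "(X, S) \<in> states I"
  shows "bind_pmf (gen_resample Expand I X (vars I - S)) (\<lambda>s. f (fst s) (snd s))
    = bind_pmf (bind_pmf (expand_chain I Expand (X, S)) (local_chain I))
        (\<lambda>s. f (fst s) (vars I - snd s))"
proof -
  have X: "X \<in> configs I (vars I)" and R: "vars I - S \<in> Pow (vars I)"
    using s by (auto simp: states_def)
  have "bind_pmf (local_resample I X R') (\<lambda>s. f (fst s) (snd s))
      = bind_pmf (local_chain I (X, vars I - R')) (\<lambda>s. f (fst s) (vars I - snd s))"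
    if "R' \<in> set_pmf (Expand X (vars I - S))" for R'
  proof -
    have R': "R' \<subseteq> vars I"
      using Ex that X R unfolding expand_subroutine_def by blast
    have "f (fst s) (snd s) = f (fst s) (vars I - (vars I - snd s))"
      if "s \<in> set_pmf (local_resample I X R')" for s
      using set_pmf_local_resample[OF I X R'] that by (auto simp: states_def double_diff)
    then show ?thesis
      using R' by (auto simp: local_chain_def bind_map_pmf split_def double_diff intro: bind_pmf_cong)
  qed
  then show ?thesis
    by (auto simp: gen_resample_def expand_chain_def bind_assoc_pmf bind_return_pmf
        intro: bind_pmf_cong)
qed

lemma set_pmf_bind_expand_chain:
  assumes "set_pmf P \<subseteq> states I"
  shows "set_pmf (bind_pmf P (expand_chain I Expand)) \<subseteq> states I"
  using assms by (fastforce simp: expand_chain_def states_def)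

lemma set_pmf_bind_local_chain:
  assumes I: "graphical_model I" and P: "set_pmf P \<subseteq> states I"
  shows "set_pmf (bind_pmf P (local_chain I)) \<subseteq> states I"
proof
  fix s assume "s \<in> set_pmf (bind_pmf P (local_chain I))"
  then obtain X S Y R where "(X, S) \<in> set_pmf P"
    "(Y, R) \<in> set_pmf (local_resample I X (vars I - S))" "s = (Y, vars I - R)"
    by (fastforce simp: local_chain_def)
  then show "s \<in> states I"
    using P set_pmf_local_resample[OF I, of X "vars I - S"] by (fastforce simp: states_def)
qed

text \<open>The factor \<open>a\<close> is left open because different unrollings of the loop return
  with different probabilities.\<close>

definition proportional :: "'a spmf \<Rightarrow> ('a \<Rightarrow> real) \<Rightarrow> bool" where
  "proportional p g \<longleftrightarrow> (\<exists>a. \<forall>x. spmf p x = a * g x)"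

text \<open>
  Inequalities between continuous functions of \<open>p\<close> are admissible for fixed point induction,
  whereas the existential quantifier in the definition is not obviously so.
\<close>

lemma proportional_iff:
  assumes g: "\<And>x. 0 \<le> g x"
  shows "proportional p g \<longleftrightarrow>
    (\<forall>x. g x = 0 \<longrightarrow> ennreal (spmf p x) \<le> 0) \<and>
    (\<forall>x y. ennreal (spmf p x) * ennreal (g y) \<le> ennreal (spmf p y) * ennreal (g x))"
    (is "_ \<longleftrightarrow> ?Z \<and> ?C")
proof
  assume "proportional p g"
  then show "?Z \<and> ?C"
    using g by (auto simp: proportional_def ennreal_mult'[symmetric] ennreal_mult[symmetric] mult_ac)
next
  assume *: "?Z \<and> ?C"
  have Z: "spmf p x = 0" if "g x = 0" for x using * that by (simp add: ennreal_eq_0_iff pmf_le_0_iff)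
  have "spmf p x * g y \<le> spmf p y * g x" for x y
    using * g by (simp add: ennreal_mult[symmetric] ennreal_le_iff)
  \<comment> \<open>Exchanging \<open>x\<close> and \<open>y\<close> turns the inequality into an
    equality.\<close>
  then have C: "spmf p x * g y = spmf p y * g x" for x y
    by (meson antisym)
  show "proportional p g"
  proof (cases "\<exists>y. g y \<noteq> 0")
    case True
    then obtain y where "g y \<noteq> 0" by blast
    then have "\<forall>x. spmf p x = spmf p y / g y * g x"
      using C[of _ y] by (simp add: field_simps)
    then show ?thesis unfolding proportional_def by blast
  next
    \<comment> \<open>If \<open>g\<close> vanishes identically, cross-multiplication says nothing,
      and the first clause is what forces \<open>p\<close> to have no mass.\<close>
    case False
    then show ?thesis unfolding proportional_def using Z by auto
  qed
qed

section \<open>Admissibility of proportionality for fixed point induction\<close>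

lemma mcont_mult_ennreal:
  assumes "mcont lub ord Sup (\<le>) f"
  shows "mcont lub ord Sup (\<le>) (\<lambda>x. f x * (c :: ennreal))"
proof (rule mcontI)
  show "monotone ord (\<le>) (\<lambda>x. f x * c)"
    using mcont_mono[OF assms] by (auto simp: monotone_def intro: mult_right_mono)
  show "cont lub ord Sup (\<le>) (\<lambda>x. f x * c)"
    by (rule contI) (simp add: mcont_contD[OF assms] SUP_mult_right_ennreal)
qed

lemma admissible_proportional:
  assumes "\<And>x. 0 \<le> g x"
  shows "spmf.admissible (\<lambda>f. proportional (bind_pmf P (\<lambda>s. f (h s))) g)"
proof -
  have m: "mcont (fun_lub lub_spmf) (fun_ord (ord_spmf (=))) Sup (\<le>)
      (\<lambda>f. ennreal (spmf (bind_pmf P (\<lambda>s. f (h s))) x))" for x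
    \<comment> \<open>A draw from a pmf becomes a draw from an spmf, to which the continuity of
      \<open>bind_spmf\<close> applies.\<close>
    unfolding bind_spmf_of_pmf[symmetric]
    by (intro mcont2mcont_ennreal_spmf mcont_bind_spmf spmf.mcont_const mcont_call)
  show ?thesis
    unfolding proportional_iff[OF assms]
    by (intro admissible_conj admissible_all admissible_imp ccpo_class.admissible_leI
      mcont_mult_ennreal m mcont_const)
qed

definition total_weight :: "'v gmodel \<Rightarrow> ('v \<Rightarrow> nat) \<Rightarrow> real" where
  "total_weight I \<sigma> = (if \<sigma> \<in> configs I (vars I) then gibbs_weight I \<sigma> else 0)"

lemma total_weight_nonneg: "graphical_model I \<Longrightarrow> 0 \<le> total_weight I \<sigma>"
  using block_weight_nonneg[of I \<sigma> "vars I"] by (simp add: total_weight_def block_weight_vars)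

text \<open>The mass of \<open>P\<close> is split by whether the loop stops. The hypothesis
  \<open>IH\<close> ranges over all laws because one iteration changes the law of the state.\<close>

lemma resample_loop_step:
  assumes I: "graphical_model I" and Ex: "expand_subroutine I Expand"
    and eq: "equilibrium_condition I (expand_chain I Expand)"
    and IH: "\<And>P. set_pmf P \<subseteq> states I \<Longrightarrow> gibbs_form I P \<Longrightarrow>
      proportional (bind_pmf P (\<lambda>s. f (fst s) (vars I - snd s))) (total_weight I)"
    and P: "set_pmf P \<subseteq> states I" and gf: "gibbs_form I P"
  shows "proportional (bind_pmf P (\<lambda>s. if vars I - snd s = {} then return_spmf (fst s)
     else bind_pmf (gen_resample Expand I (fst s) (vars I - snd s)) (\<lambda>s. f (fst s) (snd s))))
     (total_weight I)" (is "proportional ?out _")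
proof -
  let ?h = "\<lambda>s. bind_pmf (gen_resample Expand I (fst s) (vars I - snd s)) (\<lambda>s. f (fst s) (snd s))"
  let ?C = "{s. snd s \<noteq> vars I}"
  from gf obtain c where c: "\<And>S X. S \<subseteq> vars I \<Longrightarrow> X \<in> configs I (vars I) \<Longrightarrow>
      pmf P (X, S) = c S (restrict X (vars I - S)) * block_weight I S X"
    unfolding gibbs_form_def by blast
  \<comment> \<open>For \<open>S = vars I\<close> the outside part is the empty restriction
    \<open>\<lambda>_. undefined\<close>, so the coefficient is a constant.\<close>
  have stop: "pmf P (\<sigma>, vars I) = c (vars I) (\<lambda>_. undefined) * total_weight I \<sigma>" for \<sigma>
  proof (cases "\<sigma> \<in> configs I (vars I)")
    case True
    then show ?thesis using c[of "vars I" \<sigma>] by (simp add: restrict_def total_weight_def block_weight_vars[OF I])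
  next
    case False
    then have "(\<sigma>, vars I) \<notin> set_pmf P" using P by (auto simp: states_def)
    then show ?thesis using False by (simp add: total_weight_def pmf_eq_0_set_pmf)
  qed
  have "\<exists>b. \<forall>\<sigma>. (\<Sum>s\<in>states I \<inter> ?C. pmf P s * spmf (?h s) \<sigma>) = b * total_weight I \<sigma>"
  proof (cases "set_pmf P \<inter> ?C = {}")
    case True
    then have "pmf P s = 0" if "s \<in> ?C" for s using that by (auto simp: pmf_eq_0_set_pmf)
    then show ?thesis by (intro exI[of _ 0]) (auto intro!: sum.neutral)
  next
    case False
    \<comment> \<open>The equilibrium condition and \<open>IH\<close> concern probability
      distributions, so the states that continue are renormalised; this rescales \<open>c\<close>
      and sets it to zero at \<open>vars I\<close>.\<close>
    define Q where "Q = cond_pmf P ?C"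
    let ?m = "measure_pmf.prob P ?C"
    have m: "?m \<noteq> 0" using False by (simp add: measure_pmf_zero_iff)
    have Q: "pmf Q s = (if s \<in> ?C then pmf P s / ?m else 0)" for s
      unfolding Q_def by (rule pmf_cond[OF False])
    have sQ: "set_pmf Q \<subseteq> states I" using P set_cond_pmf[OF False] by (auto simp: Q_def)
    have "gibbs_form I Q"
      unfolding gibbs_form_def
      by (rule exI[of _ "\<lambda>S \<tau>. if S \<noteq> vars I then c S \<tau> / ?m else 0"]) (auto simp: Q c)
    then have "conditionally_gibbs I (bind_pmf Q (expand_chain I Expand))" (is "conditionally_gibbs I ?E")
      using eq sQ conditionally_gibbs_iff_gibbs_form[OF I sQ]
      unfolding equilibrium_condition_def by blast
    moreover have sE: "set_pmf ?E \<subseteq> states I" by (rule set_pmf_bind_expand_chain[OF sQ])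
    ultimately have gE: "gibbs_form I ?E"
      using conditionally_gibbs_iff_gibbs_form[OF I] by blast
    have "proportional (bind_pmf (bind_pmf ?E (local_chain I)) (\<lambda>s. f (fst s) (vars I - snd s)))
        (total_weight I)"
      by (intro IH set_pmf_bind_local_chain local_chain_gibbs_form I sE gE)
    also have "bind_pmf (bind_pmf ?E (local_chain I)) (\<lambda>s. f (fst s) (vars I - snd s))
       = bind_pmf Q ?h"
      unfolding bind_assoc_pmf[of Q]
    proof (rule bind_pmf_cong[OF refl])
      fix s assume "s \<in> set_pmf Q"
      then have "(fst s, snd s) \<in> states I" using sQ by auto
      from bind_gen_resample[OF I Ex this, of f]
      show "bind_pmf (bind_pmf (expand_chain I Expand s) (local_chain I))
        (\<lambda>s. f (fst s) (vars I - snd s)) = ?h s" by simp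
    qed
    finally obtain a where a: "\<And>\<sigma>. spmf (bind_pmf Q ?h) \<sigma> = a * total_weight I \<sigma>"
      unfolding proportional_def by blast
    have "(\<Sum>s\<in>states I \<inter> ?C. pmf P s * spmf (?h s) \<sigma>) = ?m * a * total_weight I \<sigma>" for \<sigma>
    proof -
      have "spmf (bind_pmf Q ?h) \<sigma> = (\<Sum>s\<in>states I \<inter> ?C. pmf Q s * spmf (?h s) \<sigma>)"
        by (rule pmf_bind_finite)
          (use sQ finite_states[OF I] set_cond_pmf[OF False] in \<open>auto simp: Q_def\<close>)
      also have "\<dots> = (\<Sum>s\<in>states I \<inter> ?C. pmf P s * spmf (?h s) \<sigma>) / ?m"
        unfolding sum_divide_distrib by (intro sum.cong) (auto simp: Q)
      finally show ?thesis using m by (simp add: a field_simps)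
    qed
    then show ?thesis by blast
  qed
  then obtain b where b: "\<And>\<sigma>. (\<Sum>s\<in>states I \<inter> ?C. pmf P s * spmf (?h s) \<sigma>) = b * total_weight I \<sigma>"
    by blast
  have "spmf ?out \<sigma> = (c (vars I) (\<lambda>_. undefined) + b) * total_weight I \<sigma>" for \<sigma>
  proof -
    let ?k = "\<lambda>s. if vars I - snd s = {} then return_spmf (fst s) else ?h s"
    \<comment> \<open>The state \<open>(\<sigma>, vars I)\<close> is added so that the stopping term
      is present even when \<open>\<sigma>\<close> is not a configuration.\<close>
    have "spmf ?out \<sigma> = (\<Sum>s\<in>states I \<union> {(\<sigma>, vars I)}. pmf P s * spmf (?k s) \<sigma>)"
      by (rule pmf_bind_finite) (use P finite_states[OF I] in auto)
    also have "\<dots> = (\<Sum>s\<in>{(\<sigma>, vars I)} \<union> (states I \<inter> ?C). pmf P s * spmf (?k s) \<sigma>)"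
    proof (rule sum.mono_neutral_right)
      show "\<forall>s\<in>states I \<union> {(\<sigma>, vars I)} - ({(\<sigma>, vars I)} \<union> states I \<inter> ?C).
          pmf P s * spmf (?k s) \<sigma> = 0"
      proof
        fix s assume "s \<in> states I \<union> {(\<sigma>, vars I)} - ({(\<sigma>, vars I)} \<union> states I \<inter> ?C)"
        then have "snd s = vars I" "fst s \<noteq> \<sigma>" by (auto simp: prod_eq_iff)
        then show "pmf P s * spmf (?k s) \<sigma> = 0" by simp
      qed
    qed (use finite_states[OF I] in auto)
    also have "\<dots> = pmf P (\<sigma>, vars I) + (\<Sum>s\<in>states I \<inter> ?C. pmf P s * spmf (?k s) \<sigma>)"
      using finite_states[OF I] by simp
    also have "(\<Sum>s\<in>states I \<inter> ?C. pmf P s * spmf (?k s) \<sigma>)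
      = (\<Sum>s\<in>states I \<inter> ?C. pmf P s * spmf (?h s) \<sigma>)"
      by (rule sum.cong) (auto simp: states_def)
    finally show ?thesis by (simp add: stop b distrib_right)
  qed
  then show ?thesis unfolding proportional_def by blast
qed

lemma resample_loop_proportional:
  assumes I: "graphical_model I" and Ex: "expand_subroutine I Expand"
    and eq: "equilibrium_condition I (expand_chain I Expand)"
    and P: "set_pmf P \<subseteq> states I" and gf: "gibbs_form I P"
  shows "proportional (bind_pmf P (\<lambda>s. resample_loop Expand I (fst s) (vars I - snd s)))
     (total_weight I)"
proof -
  have "\<forall>P. set_pmf P \<subseteq> states I \<longrightarrow> gibbs_form I P \<longrightarrow>
    proportional (bind_pmf P (\<lambda>s. resample_loop Expand I (fst s) (vars I - snd s))) (total_weight I)"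
  proof (rule resample_loop.fixp_induct)
    show "spmf.admissible (\<lambda>f. \<forall>P. set_pmf P \<subseteq> states I \<longrightarrow> gibbs_form I P \<longrightarrow>
      proportional (bind_pmf P (\<lambda>s. curry (curry (curry f)) Expand I (fst s) (vars I - snd s)))
       (total_weight I))"
      unfolding curry_def
      by (intro admissible_all admissible_imp admissible_proportional total_weight_nonneg I)
    \<comment> \<open>The bottom element never returns, so the factor is zero.\<close>
    show "\<forall>P. set_pmf P \<subseteq> states I \<longrightarrow> gibbs_form I P \<longrightarrow>
      proportional (bind_pmf P (\<lambda>s. return_pmf None)) (total_weight I)"
      by (auto simp: proportional_def intro: exI[of _ 0])
  next
    fix f :: "'a expand \<Rightarrow> 'a gmodel \<Rightarrow> ('a \<Rightarrow> nat) \<Rightarrow> 'a set \<Rightarrow> ('a \<Rightarrow> nat) spmf"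
    assume "\<forall>P. set_pmf P \<subseteq> states I \<longrightarrow> gibbs_form I P \<longrightarrow>
      proportional (bind_pmf P (\<lambda>s. f Expand I (fst s) (vars I - snd s))) (total_weight I)"
    then show "\<forall>P. set_pmf P \<subseteq> states I \<longrightarrow> gibbs_form I P \<longrightarrow>
      proportional (bind_pmf P (\<lambda>s. if vars I - snd s = {} then return_spmf (fst s)
        else bind_pmf (gen_resample Expand I (fst s) (vars I - snd s))
               (\<lambda>s. f Expand I (fst s) (snd s)))) (total_weight I)"
      using resample_loop_step[OF I Ex eq, of "f Expand I"] by blast
  qed
  then show ?thesis using P gf by blast
qed

section \<open>The updated model\<close>

lemma graphical_model_apply_update:
  "graphical_model I \<Longrightarrow> valid_update I U \<Longrightarrow> graphical_model (apply_update I U)"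
  by (auto simp: graphical_model_def valid_update_def apply_update_def configs_def)

text \<open>The Gibbs weight of \<open>I\<close> splits into a part that sees only
  \<open>vbl U\<close> and a part on the complement, and on the latter the two models agree.\<close>

lemma gibbs_form_initial:
  assumes I: "graphical_model I" and U: "valid_update I U"
    and I': "I' = apply_update I U" and p: "\<And>\<sigma>. pmf p \<sigma> = gibbs I \<sigma>"
  shows "gibbs_form I' (map_pmf (\<lambda>X. (X, vars I' - vbl U)) p)"
proof -
  note V = graphical_modelD(1)[OF I] and finE = graphical_modelD(2)[OF I]
  have vars: "vars I' = vars I" and configs: "configs I' S = configs I S" for S
    by (auto simp: I' apply_update_def configs_def)
  have vbl: "vbl U \<subseteq> vars I"
    using U by (auto simp: vbl_def valid_update_def)
  let ?S = "vars I - vbl U"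
  let ?Z = "\<Sum>\<sigma>\<in>configs I (vars I). gibbs_weight I \<sigma>"
  \<comment> \<open>The weight of the old model inside \<open>vbl U\<close>, divided by the old
    partition function.\<close>
  let ?c = "\<lambda>\<rho>. (\<Prod>v\<in>vbl U. pmf (vfun I v) (\<rho> v)) *
      (\<Prod>e\<in>{e \<in> constraints I. e \<subseteq> vbl U}. cfun I e (restrict \<rho> e)) / ?Z"
  have w: "gibbs_weight I X / ?Z = ?c (restrict X (vbl U)) * block_weight I' ?S X" for X
  proof -
    have "(\<Prod>v\<in>vars I. pmf (vfun I v) (X v))
      = (\<Prod>v\<in>?S. pmf (vfun I v) (X v)) * (\<Prod>v\<in>vbl U. pmf (vfun I v) (X v))"
      by (rule prod.subset_diff[OF vbl V])
    also have "(\<Prod>v\<in>?S. pmf (vfun I v) (X v)) = (\<Prod>v\<in>?S. pmf (vfun I' v) (X v))"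
      by (intro prod.cong) (auto simp: I' apply_update_def vbl_def)
    also have "(\<Prod>v\<in>vbl U. pmf (vfun I v) (X v))
      = (\<Prod>v\<in>vbl U. pmf (vfun I v) (restrict X (vbl U) v))"
      by (intro prod.cong) auto
    finally have v: "(\<Prod>v\<in>vars I. pmf (vfun I v) (X v)) = (\<Prod>v\<in>?S. pmf (vfun I' v) (X v)) *
      (\<Prod>v\<in>vbl U. pmf (vfun I v) (restrict X (vbl U) v))" .
    have "(\<Prod>e\<in>constraints I. cfun I e (restrict X e))
      = (\<Prod>e\<in>{e \<in> constraints I. e \<inter> ?S \<noteq> {}}. cfun I e (restrict X e)) *
        (\<Prod>e\<in>{e \<in> constraints I. e \<subseteq> vbl U}. cfun I e (restrict X e))"
      using graphical_modelD(3)[OF I]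
      by (subst prod.union_disjoint[symmetric]) (auto simp: finE intro!: prod.cong)
    \<comment> \<open>An updated constraint lies inside \<open>vbl U\<close>, so a constraint
      meeting the complement is the same in both models, with the same function.\<close>
    also have "(\<Prod>e\<in>{e \<in> constraints I. e \<inter> ?S \<noteq> {}}. cfun I e (restrict X e))
      = (\<Prod>e\<in>{e \<in> constraints I'. e \<inter> ?S \<noteq> {}}. cfun I' e (restrict X e))"
      by (intro prod.cong) (auto simp: I' apply_update_def vbl_def)
    also have "(\<Prod>e\<in>{e \<in> constraints I. e \<subseteq> vbl U}. cfun I e (restrict X e))
      = (\<Prod>e\<in>{e \<in> constraints I. e \<subseteq> vbl U}. cfun I e (restrict (restrict X (vbl U)) e))"
      by (intro prod.cong refl) (simp add: restrict_restrict_subset del: restrict_restrict)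
    finally show ?thesis
      unfolding gibbs_weight_def block_weight_def v by (simp add: mult_ac del: restrict_apply restrict_restrict)
  qed
  show ?thesis
    unfolding gibbs_form_def vars configs
  proof (intro exI[of _ "\<lambda>S \<rho>. if S = ?S then ?c \<rho> else 0"] allI impI)
    fix S X assume X: "X \<in> configs I (vars I)"
    have "pmf (map_pmf (\<lambda>X. (X, ?S)) p) (X, S) = (if S = ?S then pmf p X else 0)"
      by (auto simp: pmf_map vimage_def measure_pmf_single)
    also have "\<dots> = (if S = ?S then ?c (restrict X (vars I - S)) else 0) * block_weight I' S X"
      using X vbl by (auto simp: p gibbs_def w double_diff simp del: restrict_apply)
    finally show "pmf (map_pmf (\<lambda>X. (X, ?S)) p) (X, S) =
       (if S = ?S then ?c (restrict X (vars I - S)) else 0) * block_weight I' S X" .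
  qed
qed

text \<open>The factor \<open>a\<close> occurs in the probability of each output and in that of
  termination; it cancels, since a positive termination probability excludes
  \<open>a = 0\<close>.\<close>

lemma cond_prob_proportional:
  assumes I: "graphical_model I" and A: "proportional A (total_weight I)"
    and pos: "\<P>(r in measure_pmf A. r \<noteq> None) > 0"
  shows "\<P>(r in measure_pmf A. r = Some \<sigma> \<bar> r \<noteq> None) = gibbs I \<sigma>"
proof -
  obtain a where a: "\<And>\<sigma>. spmf A \<sigma> = a * total_weight I \<sigma>"
    using A unfolding proportional_def by blast
  let ?C = "configs I (vars I)"
  have fin: "finite ?C" using finite_configs graphical_modelD(1)[OF I] by blast
  have "measure_pmf.prob A {r. r \<noteq> None} = measure_pmf.prob A (Some ` ?C)"
  proof (rule measure_pmf.finite_measure_eq_AE)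
    show "AE r in measure_pmf A. (r \<in> {r. r \<noteq> None}) = (r \<in> Some ` ?C)"
    proof (rule AE_pmfI)
      fix r assume r: "r \<in> set_pmf A"
      show "(r \<in> {r. r \<noteq> None}) = (r \<in> Some ` ?C)"
      proof (cases r)
        case (Some \<sigma>)
        then have "\<sigma> \<in> ?C" using r a[of \<sigma>] by (auto simp: set_pmf_iff total_weight_def split: if_splits)
        then show ?thesis using Some by auto
      qed auto
    qed
  qed simp_all
  also have "\<dots> = (\<Sum>\<sigma>\<in>?C. spmf A \<sigma>)"
    by (subst measure_measure_pmf_finite) (auto simp: fin sum.reindex)
  also have "\<dots> = a * (\<Sum>\<sigma>\<in>?C. gibbs_weight I \<sigma>)"
    unfolding sum_distrib_left by (rule sum.cong) (auto simp: a total_weight_def)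
  finally have Z: "measure_pmf.prob A {r. r \<noteq> None} = a * (\<Sum>\<sigma>\<in>?C. gibbs_weight I \<sigma>)" .
  have "{r. r = Some \<sigma> \<and> r \<noteq> None} = {Some \<sigma>}" by auto
  then have "\<P>(r in measure_pmf A. r = Some \<sigma> \<bar> r \<noteq> None)
    = a * total_weight I \<sigma> / (a * (\<Sum>\<sigma>\<in>?C. gibbs_weight I \<sigma>))"
    unfolding cond_prob_pmf Z by (simp add: measure_pmf_single a)
  moreover have "a \<noteq> 0" using pos Z by auto
  ultimately show ?thesis by (simp add: gibbs_def total_weight_def)
qed

theorem theorem5:
  fixes I I' :: "'v gmodel" and U :: "'v gupdate"
    and Expand :: "'v expand" and p :: "('v \<Rightarrow> nat) pmf"
  assumes "graphical_model I"
    and "valid_update I U"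
    and "I' = apply_update I U"
    and "expand_subroutine I' Expand"
    and "equilibrium_condition I' (expand_chain I' Expand)"
    and "\<And>\<sigma>. pmf p \<sigma> = gibbs I \<sigma>"
    and "A = bind_pmf p (dynamic_sampling Expand I U)"
    and "\<P>(r in measure_pmf A. r \<noteq> None) > 0"
  shows "\<forall>\<sigma>. \<P>(r in measure_pmf A. r = Some \<sigma> \<bar> r \<noteq> None) = gibbs I' \<sigma>"
proof -
  have I': "graphical_model I'"
    using assms(1-3) graphical_model_apply_update by blast
  have vbl: "vbl U \<subseteq> vars I'"
    using assms(2,3) by (auto simp: vbl_def valid_update_def apply_update_def)
  \<comment> \<open>The loop starts with resample set \<open>vbl U\<close>, whose complement is the
    set component of the initial state.\<close>
  let ?P = "map_pmf (\<lambda>X. (X, vars I' - vbl U)) p"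
  have "X \<in> configs I' (vars I')" if "X \<in> set_pmf p" for X
    using that assms(3)
    by (auto simp: set_pmf_iff assms(6) gibbs_def apply_update_def configs_def split: if_split_asm)
  then have P: "set_pmf ?P \<subseteq> states I'" by (auto simp: states_def)
  have "A = bind_pmf ?P (\<lambda>s. resample_loop Expand I' (fst s) (vars I' - snd s))"
    using vbl by (simp add: assms(3,7) bind_map_pmf dynamic_sampling_def[abs_def] double_diff)
  then have "proportional A (total_weight I')"
    using resample_loop_proportional[OF I' assms(4,5) P gibbs_form_initial[OF assms(1-3,6)]]
    by simp
  then show ?thesis using cond_prob_proportional[OF I' _ assms(8)] by blast
qed

end
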